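(* Let $f\in C_{2\pi}^{(\mathcal{F})}(\mathbb{R}^2)$. For $m,n\in\mathbb{N}$ let $F_{mn}$ be the double fuzzy Fejér operator $$F_{mn}(f;u,v)=\frac{1}{4\pi^2}\int_{-\pi}^{\pi}\int_{-\pi}^{\pi}f(u-x,v-y)\,\phi_m(x)\,\phi_n(y)\,dx\,dy,\qquad (u,v)\in\mathbb{R}^2,$$ where $$\phi_m(u)=\begin{cases}\dfrac{\sin^2[(m+1)u/2]}{(m+1)\sin^2[u/2]} & \text{if } u \text{ is not a multiple of } 2\pi,\\[2mm] m+1 & \text{if } u \text{ is a multiple of } 2\pi.\end{cases}$$ Then $F_{mn}(f)\to f$ uniformly, i.e. $$\lim_{m,n\to\infty}D^*\left(F_{mn}(f),f\right)=0.$$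
   Context: A fuzzy number is a function $\mu:\mathbb{R}\to[0,1]$ that is normal ($\mu(t_0)=1$ for some $t_0$), fuzzy convex ($\mu(\lambda s+(1-\lambda)t)\ge\min\{\mu(s),\mu(t)\}$ for $\lambda\in[0,1]$), upper semicontinuous, and has compact support $\overline{\{t:\mu(t)>0\}}$. $\mathbb{R}_{\mathcal{F}}$ is the set of fuzzy numbers. The $\alpha$-level set is $[\mu]_\alpha=\{t:\mu(t)\ge\alpha\}$ for $0<\alpha\le1$ and $[\mu]_0=\overline{\{t:\mu(t)>0\}}$; it is a compact interval written $[\mu]_\alpha=[\mu_\alpha^-,\mu_\alpha^+]$. Scalar multiplication is levelwise: $[k\mu]_\alpha=k[\mu]_\alpha$. The metric on $\mathbb{R}_{\mathcal{F}}$ is $D(\mu,\eta)=\sup_{\alpha\in[0,1]}\max\{|\mu_\alpha^--\eta_\alpha^-|,|\mu_\alpha^+-\eta_\alpha^+|\}$. A function on $\mathbb{R}^2$ is $2\pi$-periodic if $f(u,v)=f(u+2n\pi,v)=f(u,v+2n\pi)$ for all $n\in\mathbb{Z}$ and all $(u,v)$. $C_{2\pi}^{(\mathcal{F})}(\mathbb{R}^2)$ is the set of $2\pi$-periodic functions $f:\mathbb{R}^2\to\mathbb{R}_{\mathcal{F}}$ that are continuous with respect to $D$, with the metric $D^*(f,g)=\sup_{(u,v)\in\mathbb{R}^2}D(f(u,v),g(u,v))$. Integrals of fuzzy valued functions are fuzzy Riemann integrals: for a continuous $g:[a,b]\times[c,d]\to\mathbb{R}_{\mathcal{F}}$ with $[g(x,y)]_\alpha=[g_\alpha^-(x,y),g_\alpha^+(x,y)]$,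 the integral $\int_c^d\int_a^b g\,dx\,dy$ is the fuzzy number whose $\alpha$-level sets are $\left[\int_c^d\int_a^b g_\alpha^-\,dx\,dy,\ \int_c^d\int_a^b g_\alpha^+\,dx\,dy\right]$, $\alpha\in[0,1]$ (it is a known fact that this is a fuzzy number). Limits of double sequences are in the Pringsheim sense: $\lim_{m,n\to\infty}x_{mn}=L$ means that for every $\varepsilon>0$ there is $N$ with $|x_{mn}-L|<\varepsilon$ for all $m,n\ge N$. *)

theory Defs
  imports "HOL-Analysis.Analysis"
begin

section \<open>Fuzzy numbers\<close>

definition usc :: "(real \<Rightarrow> real) \<Rightarrow> bool" where
  "usc \<mu> \<longleftrightarrow> (\<forall>t y. \<mu> t < y \<longrightarrow> (\<forall>\<^sub>F s in nhds t. \<mu> s < y))"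

definition is_fuzzy_number :: "(real \<Rightarrow> real) \<Rightarrow> bool" where
  "is_fuzzy_number \<mu> \<longleftrightarrow>
     (\<forall>t. 0 \<le> \<mu> t \<and> \<mu> t \<le> 1) \<and>
     (\<exists>t\<^sub>0. \<mu> t\<^sub>0 = 1) \<and>
     (\<forall>s t. \<forall>l\<in>{0..1}. \<mu> (l * s + (1 - l) * t) \<ge> min (\<mu> s) (\<mu> t)) \<and>
     usc \<mu> \<and>
     compact (closure {t. \<mu> t > 0})"

typedef fuzzy = "{\<mu>. is_fuzzy_number \<mu>}"
  morphisms membership Abs_fuzzy
proof
  have *: "min (indicat_real {0} s) (indicat_real {0} t) \<le> indicat_real {0} (l * s + (1 - l) * t)"
    for s t l :: real
    by (auto simp: indicator_def)
  have "usc (indicat_real {0})"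
    unfolding usc_def
  proof (intro allI impI)
    fix t y :: real assume ty: "indicat_real {0} t < y"
    show "\<forall>\<^sub>F s in nhds t. indicat_real {0} s < y"
    proof (cases "t = 0")
      case True
      with ty show ?thesis by (auto simp: indicator_def intro!: always_eventually)
    next
      case False
      then have "\<forall>\<^sub>F s in nhds t. s \<noteq> 0" by (rule t1_space_nhds)
      then show ?thesis 
        by (rule eventually_mono) (use ty False in \<open>simp add: indicator_def\<close>)
    qed
  qed
  moreover have "{t. indicat_real {0} t > 0} = {0}" by (auto simp: indicator_def)
  ultimately have "is_fuzzy_number (indicat_real {0})"
    using * unfolding is_fuzzy_number_def by (auto simp: indicator_def)
  then show "indicat_real {0} \<in> {\<mu>. is_fuzzy_number \<mu>}" by simp
qed

definition level :: "fuzzy \<Rightarrow> real \<Rightarrow> real set" where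
  "level \<mu> \<alpha> =
     (if \<alpha> = 0 then closure {t. membership \<mu> t > 0} else {t. membership \<mu> t \<ge> \<alpha>})"

text \<open>The endpoints of the level intervals; see \<open>level_eq\<close> below.\<close>

definition lo :: "fuzzy \<Rightarrow> real \<Rightarrow> real" where
  "lo \<mu> \<alpha> = Inf (level \<mu> \<alpha>)"

definition hi :: "fuzzy \<Rightarrow> real \<Rightarrow> real" where
  "hi \<mu> \<alpha> = Sup (level \<mu> \<alpha>)"

lemma fuzzy_props:
  shows "0 \<le> membership \<mu> t" "membership \<mu> t \<le> 1"
    and "\<exists>t\<^sub>0. membership \<mu> t\<^sub>0 = 1"
    and "l \<in> {0..1} \<Longrightarrow> membership \<mu> (l * s + (1 - l) * t) \<ge> min (membership \<mu> s) (membership \<mu> t)"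
    and "usc (membership \<mu>)"
    and "compact (closure {t. membership \<mu> t > 0})"
  using membership[of \<mu>] by (auto simp: is_fuzzy_number_def)

lemma closed_superlevel:
  assumes "usc \<mu>" shows "closed {t. \<mu> t \<ge> \<alpha>}"
proof -
  have "open {t. \<mu> t < \<alpha>}"
  proof (subst open_subopen, intro ballI)
    fix t assume "t \<in> {t. \<mu> t < \<alpha>}"
    with assms have "\<forall>\<^sub>F s in nhds t. \<mu> s < \<alpha>" unfolding usc_def by blast
    then show "\<exists>T. open T \<and> t \<in> T \<and> T \<subseteq> {t. \<mu> t < \<alpha>}"
      unfolding eventually_nhds by blast
  qed
  moreover have "- {t. \<mu> t < \<alpha>} = {t. \<mu> t \<ge> \<alpha>}" by auto
  ultimately show ?thesis by (metis closed_Compl)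
qed

lemma level_subset_0:
  assumes "\<alpha> \<in> {0..1}" shows "level \<mu> \<alpha> \<subseteq> level \<mu> 0"
proof (cases "\<alpha> = 0")
  case False
  then have "{t. membership \<mu> t \<ge> \<alpha>} \<subseteq> {t. membership \<mu> t > 0}" using assms by auto
  then show ?thesis using False closure_subset by (fastforce simp: level_def)
qed simp

lemma compact_level:
  assumes "\<alpha> \<in> {0..1}" shows "compact (level \<mu> \<alpha>)"
proof -
  have "compact (level \<mu> 0)" unfolding level_def if_P[OF refl] by (rule fuzzy_props(6))
  moreover have "closed (level \<mu> \<alpha>)"
    by (simp add: level_def closed_superlevel[OF fuzzy_props(5)])
  ultimately show ?thesis
    using level_subset_0[OF assms, of \<mu>] compact_Int_closed[of "level \<mu> 0" "level \<mu> \<alpha>"]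
    by (simp add: inf.absorb2)
qed

lemma level_nonempty:
  assumes "\<alpha> \<in> {0..1}" shows "level \<mu> \<alpha> \<noteq> {}"
proof -
  obtain t where t: "membership \<mu> t = 1" using fuzzy_props(3) by blast
  then have "t \<in> level \<mu> 1" by (simp add: level_def)
  show ?thesis
  proof (cases "\<alpha> = 0")
    case True
    with \<open>t \<in> level \<mu> 1\<close> level_subset_0[of 1 \<mu>] show ?thesis by auto
  next
    case False
    with t assms have "t \<in> level \<mu> \<alpha>" by (auto simp: level_def)
    then show ?thesis by blast
  qed
qed

lemma convex_level: "convex (level \<mu> \<alpha>)"
proof -
  have *: "min (membership \<mu> s) (membership \<mu> t) \<le> membership \<mu> (u * s + v * t)"
    if "0 \<le> u" "0 \<le> v" "u + v = 1" for s t u v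
  proof -
    from that have "v = 1 - u" "u \<in> {0..1}" by auto
    then show ?thesis using fuzzy_props(4)[of u \<mu> s t] by simp
  qed
  have "convex {t. membership \<mu> t > 0}" "convex {t. membership \<mu> t \<ge> \<alpha>}"
    unfolding convex_def real_scaleR_def
    using less_le_trans[OF _ *, of 0] order_trans[OF _ *, of \<alpha>] by simp_all
  then show ?thesis by (simp add: level_def convex_closure)
qed

lemma level_eq:
  assumes "\<alpha> \<in> {0..1}" shows "level \<mu> \<alpha> = {lo \<mu> \<alpha>..hi \<mu> \<alpha>}"
proof -
  note c = compact_level[OF assms, of \<mu>] and n = level_nonempty[OF assms, of \<mu>]
  obtain a b where ab: "level \<mu> \<alpha> = {a..b}"
    using c convex_connected[OF convex_level] connected_compact_interval_1 by blast
  then have "a \<le> b" using n by auto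
  then show ?thesis by (simp add: lo_def hi_def ab)
qed

lemma fuzzy_eqI:
  assumes "\<And>\<alpha>. \<alpha> \<in> {0..1} \<Longrightarrow> level \<mu> \<alpha> = level \<nu> \<alpha>"
  shows "\<mu> = \<nu>"
proof -
  have le: "membership \<mu> t \<le> membership \<nu> t"
    if "\<And>\<alpha>. \<alpha> \<in> {0..1} \<Longrightarrow> level \<mu> \<alpha> = level \<nu> \<alpha>" for \<mu> \<nu> t
  proof (cases "membership \<mu> t = 0")
    case False
    then have "t \<in> level \<mu> (membership \<mu> t)" by (simp add: level_def)
    then have "t \<in> level \<nu> (membership \<mu> t)" using that fuzzy_props(1,2) by auto
    then show ?thesis using False by (simp add: level_def)
  qed (simp add: fuzzy_props(1))
  have "membership \<mu> = membership \<nu>"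
    using le[of \<mu> \<nu>] le[of \<nu> \<mu>] assms by (intro ext antisym) auto
  then show ?thesis by (simp add: membership_inject)
qed

section \<open>The metric \<open>D\<close>\<close>

definition fuzzy_D :: "fuzzy \<Rightarrow> fuzzy \<Rightarrow> real" where
  "fuzzy_D \<mu> \<eta> = (SUP \<alpha>\<in>{0..1}. max \<bar>lo \<mu> \<alpha> - lo \<eta> \<alpha>\<bar> \<bar>hi \<mu> \<alpha> - hi \<eta> \<alpha>\<bar>)"

lemma endpoints_in_level_0:
  assumes "\<alpha> \<in> {0..1}"
  shows "lo \<mu> 0 \<le> lo \<mu> \<alpha>" "lo \<mu> \<alpha> \<le> hi \<mu> \<alpha>" "hi \<mu> \<alpha> \<le> hi \<mu> 0"
proof -
  have "{lo \<mu> \<alpha>..hi \<mu> \<alpha>} \<noteq> {}" using level_nonempty[OF assms] level_eq[OF assms] by metis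
  then show 1: "lo \<mu> \<alpha> \<le> hi \<mu> \<alpha>" by simp
  have "{lo \<mu> \<alpha>..hi \<mu> \<alpha>} \<subseteq> {lo \<mu> 0..hi \<mu> 0}"
    using level_subset_0[OF assms, of \<mu>] level_eq[OF assms] level_eq[of 0] by auto
  with 1 show "lo \<mu> 0 \<le> lo \<mu> \<alpha>" "hi \<mu> \<alpha> \<le> hi \<mu> 0" by auto
qed

lemma bdd_above_fuzzy_D:
  "bdd_above ((\<lambda>\<alpha>. max \<bar>lo \<mu> \<alpha> - lo \<eta> \<alpha>\<bar> \<bar>hi \<mu> \<alpha> - hi \<eta> \<alpha>\<bar>) ` {0..1})"
proof (rule bdd_aboveI2)
  fix \<alpha> :: real assume "\<alpha> \<in> {0..1}"
  note * = endpoints_in_level_0[OF this]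
  show "max \<bar>lo \<mu> \<alpha> - lo \<eta> \<alpha>\<bar> \<bar>hi \<mu> \<alpha> - hi \<eta> \<alpha>\<bar>
      \<le> \<bar>lo \<mu> 0\<bar> + \<bar>hi \<mu> 0\<bar> + \<bar>lo \<eta> 0\<bar> + \<bar>hi \<eta> 0\<bar>"
    using *[of \<mu>] *[of \<eta>] by (intro max.boundedI) linarith+
qed

lemma fuzzy_D_upper:
  assumes "\<alpha> \<in> {0..1}"
  shows "\<bar>lo \<mu> \<alpha> - lo \<eta> \<alpha>\<bar> \<le> fuzzy_D \<mu> \<eta>" "\<bar>hi \<mu> \<alpha> - hi \<eta> \<alpha>\<bar> \<le> fuzzy_D \<mu> \<eta>"
  using cSUP_upper[OF assms bdd_above_fuzzy_D, of \<mu> \<eta>]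
  by (auto simp: fuzzy_D_def)

instantiation fuzzy :: metric_space
begin

definition dist_fuzzy :: "fuzzy \<Rightarrow> fuzzy \<Rightarrow> real" where
  "dist_fuzzy = fuzzy_D"

definition uniformity_fuzzy :: "(fuzzy \<times> fuzzy) filter" where
  "uniformity_fuzzy = (INF e\<in>{0 <..}. principal {(\<mu>, \<eta>). dist \<mu> \<eta> < e})"

definition open_fuzzy :: "fuzzy set \<Rightarrow> bool" where
  "open_fuzzy U \<longleftrightarrow> (\<forall>\<mu>\<in>U. \<forall>\<^sub>F (\<mu>', \<eta>) in uniformity. \<mu>' = \<mu> \<longrightarrow> \<eta> \<in> U)"

instance
proof
  fix \<mu> \<eta> \<nu> :: fuzzy
  show "dist \<mu> \<eta> = 0 \<longleftrightarrow> \<mu> = \<eta>"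
  proof
    assume "dist \<mu> \<eta> = 0"
    then have "level \<mu> \<alpha> = level \<eta> \<alpha>" if "\<alpha> \<in> {0..1}" for \<alpha>
      using fuzzy_D_upper[OF that, of \<mu> \<eta>] by (simp add: level_eq[OF that] dist_fuzzy_def)
    then show "\<mu> = \<eta>" by (rule fuzzy_eqI)
  qed (simp add: dist_fuzzy_def fuzzy_D_def)
  show "dist \<mu> \<eta> \<le> dist \<mu> \<nu> + dist \<eta> \<nu>"
    unfolding dist_fuzzy_def fuzzy_D_def[of \<mu> \<eta>]
  proof (rule cSUP_least)
    fix \<alpha> :: real assume a: "\<alpha> \<in> {0..1}"
    show "max \<bar>lo \<mu> \<alpha> - lo \<eta> \<alpha>\<bar> \<bar>hi \<mu> \<alpha> - hi \<eta> \<alpha>\<bar> \<le> fuzzy_D \<mu> \<nu> + fuzzy_D \<eta> \<nu>"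
      using fuzzy_D_upper[OF a, of \<mu> \<nu>] fuzzy_D_upper[OF a, of \<eta> \<nu>] by auto
  qed simp
qed (rule uniformity_fuzzy_def open_fuzzy_def)+

end

section \<open>Levelwise operations\<close>

text \<open>
  The fuzzy number with the given level sets. By \<open>fuzzy_eqI\<close> there is at most one,
  but \<open>L\<close> must satisfy the usual monotonicity and continuity conditions for one to exist.
\<close>

definition fuzzy_of_levels :: "(real \<Rightarrow> real set) \<Rightarrow> fuzzy" where
  "fuzzy_of_levels L = (THE \<nu>. \<forall>\<alpha>\<in>{0..1}. level \<nu> \<alpha> = L \<alpha>)"

lemma fuzzy_of_levels_eqI:
  assumes "\<And>\<alpha>. \<alpha> \<in> {0..1} \<Longrightarrow> level \<nu> \<alpha> = L \<alpha>"
  shows "fuzzy_of_levels L = \<nu>"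
  unfolding fuzzy_of_levels_def
proof (rule the_equality)
  show "\<forall>\<alpha>\<in>{0..1}. level \<nu> \<alpha> = L \<alpha>" using assms by blast
  show "\<eta> = \<nu>" if "\<forall>\<alpha>\<in>{0..1}. level \<eta> \<alpha> = L \<alpha>" for \<eta>
    using that assms by (intro fuzzy_eqI) metis
qed

definition fscale :: "real \<Rightarrow> fuzzy \<Rightarrow> fuzzy" where
  "fscale k \<mu> = fuzzy_of_levels (\<lambda>\<alpha>. (*) k ` level \<mu> \<alpha>)"

definition fuzzy_integral2 ::
    "real \<Rightarrow> real \<Rightarrow> real \<Rightarrow> real \<Rightarrow> (real \<Rightarrow> real \<Rightarrow> fuzzy) \<Rightarrow> fuzzy" where
  "fuzzy_integral2 a b c d g = fuzzy_of_levels (\<lambda>\<alpha>.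
     {integral {c..d} (\<lambda>y. integral {a..b} (\<lambda>x. lo (g x y) \<alpha>)) ..
      integral {c..d} (\<lambda>y. integral {a..b} (\<lambda>x. hi (g x y) \<alpha>))})"

section \<open>Periodic fuzzy valued functions and the double Fejer operator\<close>

definition periodic_2pi :: "(real \<times> real \<Rightarrow> 'a) \<Rightarrow> bool" where
  "periodic_2pi f \<longleftrightarrow> (\<forall>(n::int) u v.
     f (u, v) = f (u + 2 * of_int n * pi, v) \<and> f (u, v) = f (u, v + 2 * of_int n * pi))"

definition C_2pi_fuzzy :: "(real \<times> real \<Rightarrow> fuzzy) set" where
  "C_2pi_fuzzy = {f. periodic_2pi f \<and> continuous_on UNIV f}"

definition Dstar :: "(real \<times> real \<Rightarrow> fuzzy) \<Rightarrow> (real \<times> real \<Rightarrow> fuzzy) \<Rightarrow> real" where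
  "Dstar f g = (SUP p. fuzzy_D (f p) (g p))"

text \<open>
  A supremum in the reals, so it says something only if the distances are bounded:
\<close>

lemma bounded_C_2pi_fuzzy:
  assumes "f \<in> C_2pi_fuzzy" shows "bounded (range f)"
proof -
  let ?K = "cbox (0, 0) (2 * pi, 2 * pi)"
  have red: "\<exists>n::int. x + 2 * of_int n * pi \<in> {0..2 * pi}" for x :: real
  proof
    have "of_int \<lfloor>x / (2 * pi)\<rfloor> * (2 * pi) \<le> x" "x < (of_int \<lfloor>x / (2 * pi)\<rfloor> + 1) * (2 * pi)"
      by (simp_all add: floor_divide_lower floor_divide_upper)
    then show "x + 2 * of_int (- \<lfloor>x / (2 * pi)\<rfloor>) * pi \<in> {0..2 * pi}"
      by (simp add: algebra_simps)
  qed
  have per: "f (u, v) = f (u + 2 * of_int n * pi, v)" "f (u, v) = f (u, v + 2 * of_int n * pi)"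
    for n :: int and u v
    using assms by (auto simp: C_2pi_fuzzy_def periodic_2pi_def)
  have "f (u, v) \<in> f ` ?K" for u v
  proof -
    obtain m where m: "u + 2 * of_int m * pi \<in> {0..2 * pi}" using red by blast
    obtain n where n: "v + 2 * of_int n * pi \<in> {0..2 * pi}" using red by blast
    have "f (u, v) = f (u + 2 * of_int m * pi, v + 2 * of_int n * pi)"
      using per by metis
    moreover have "(u + 2 * of_int m * pi, v + 2 * of_int n * pi) \<in> ?K"
      using m n by (simp add: cbox_Pair_eq)
    ultimately show ?thesis by blast
  qed
  then have "range f \<subseteq> f ` ?K" by auto
  moreover have "compact (f ` ?K)"
    using assms by (intro compact_continuous_image)
      (auto simp: C_2pi_fuzzy_def intro: continuous_on_subset)
  ultimately show ?thesis using compact_imp_bounded bounded_subset by blast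
qed

lemma bdd_above_Dstar:
  assumes "f \<in> C_2pi_fuzzy" "g \<in> C_2pi_fuzzy"
  shows "bdd_above (range (\<lambda>p. fuzzy_D (f p) (g p)))"
  unfolding dist_fuzzy_def[symmetric]
  by (intro bounded_imp_bdd_above bounded_dist_comp bounded_C_2pi_fuzzy assms)

definition fejer_kernel :: "nat \<Rightarrow> real \<Rightarrow> real" where
  "fejer_kernel m u =
     (if \<exists>k::int. u = of_int k * (2 * pi) then real m + 1
      else (sin ((real m + 1) * u / 2))\<^sup>2 / ((real m + 1) * (sin (u / 2))\<^sup>2))"

definition fejer_op ::
    "nat \<Rightarrow> nat \<Rightarrow> (real \<times> real \<Rightarrow> fuzzy) \<Rightarrow> real \<times> real \<Rightarrow> fuzzy" where
  "fejer_op m n f = (\<lambda>(u, v). fscale (1 / (4 * pi\<^sup>2))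
     (fuzzy_integral2 (- pi) pi (- pi) pi
       (\<lambda>x y. fscale (fejer_kernel m x * fejer_kernel n y) (f (u - x, v - y)))))"

definition pringsheim_lim :: "(nat \<Rightarrow> nat \<Rightarrow> real) \<Rightarrow> real \<Rightarrow> bool" where
  "pringsheim_lim x L \<longleftrightarrow> (\<forall>\<epsilon>>0. \<exists>N. \<forall>m\<ge>N. \<forall>n\<ge>N. \<bar>x m n - L\<bar> < \<epsilon>)"

end

theory Submission
  imports Defs
begin

text \<open>
  The endpoints of the level intervals of a fuzzy number are monotone in the level,
  left-continuous, and right-continuous at 0; conversely, such endpoints determine a fuzzy
  number. These properties survive scaling by a nonnegative factor and, by dominated convergence,
  integration, so the endpoints of the Fejer means of \<open>f\<close> are the real Fejer means of the endpoints
  of \<open>f\<close>.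

  By periodicity \<open>f\<close> is uniformly continuous and bounded, whence
  \<open>D (f (u - x, v - y)) (f (u, v)) \<le> \<epsilon> + C (sin\<^sup>2 (x/2) + sin\<^sup>2 (y/2))\<close> for \<open>x\<close>, \<open>y\<close> in \<open>[-\<pi>, \<pi>]\<close>.
  The kernel is nonnegative with integral \<open>2 \<pi>\<close>, and
  \<open>\<phi>\<^sub>m x sin\<^sup>2 (x/2) \<le> 1/(m + 1)\<close>, so averaging gives
  \<open>D (F\<^sub>m\<^sub>n f p) (f p) \<le> \<epsilon> + C (1/(m + 1) + 1/(n + 1))\<close>, uniformly in \<open>p\<close> and in the level.
\<close>

section \<open>Endpoint functions of fuzzy numbers\<close>

text \<open>
  The upper endpoint \<open>hi\<close> decreases in the level; it is \<open>- hi\<close> that is an endpoint function.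
\<close>

definition endpoint_fun :: "(real \<Rightarrow> real) \<Rightarrow> bool" where
  "endpoint_fun A \<longleftrightarrow> mono_on {0..1} A \<and>
     (\<forall>\<alpha>\<in>{0<..1}. (A \<longlongrightarrow> A \<alpha>) (at_left \<alpha>)) \<and> (A \<longlongrightarrow> A 0) (at_right 0)"

lemma endpoint_funD:
  assumes "endpoint_fun A"
  shows "0 \<le> \<alpha> \<Longrightarrow> \<alpha> \<le> \<beta> \<Longrightarrow> \<beta> \<le> 1 \<Longrightarrow> A \<alpha> \<le> A \<beta>"
    and "0 < \<alpha> \<Longrightarrow> \<alpha> \<le> 1 \<Longrightarrow> (A \<longlongrightarrow> A \<alpha>) (at_left \<alpha>)"
    and "(A \<longlongrightarrow> A 0) (at_right 0)"
  using assms by (auto simp: endpoint_fun_def mono_on_def)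

lemma endpoint_fun_mult:
  assumes "endpoint_fun A" "0 \<le> k"
  shows "endpoint_fun (\<lambda>\<alpha>. k * A \<alpha>)"
  using assms by (auto simp: endpoint_fun_def mono_on_def intro!: mult_left_mono tendsto_intros)

text \<open>By left continuity a bound valid at all smaller positive levels passes to the limit.
  Applied to \<open>A\<close> and \<open>- B\<close>, it shows below that a supremum of levels is
  attained.\<close>

lemma endpoint_fun_le_at_limit:
  assumes "endpoint_fun A" "0 < \<alpha>" "\<alpha> \<le> 1" "\<And>\<beta>. 0 < \<beta> \<Longrightarrow> \<beta> < \<alpha> \<Longrightarrow> A \<beta> \<le> t"
  shows "A \<alpha> \<le> t"
proof (rule tendsto_upperbound)
  show "(A \<longlongrightarrow> A \<alpha>) (at_left \<alpha>)" by (rule endpoint_funD(2)) fact+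
  show "\<forall>\<^sub>F \<beta> in at_left \<alpha>. A \<beta> \<le> t"
    using eventually_at_left_real[OF assms(2)] by eventually_elim (simp add: assms(4))
qed simp

text \<open>The converse half of the Goetschel-Voxman representation. The membership of
  \<open>t\<close> is the supremum of the levels whose interval contains \<open>t\<close>.
  Monotonicity nests the intervals, left continuity makes the superlevel sets equal to them, and
  right continuity at 0 identifies the closure of the support.\<close>

lemma ex_fuzzy_of_endpoints:
  assumes A: "endpoint_fun A" and B: "endpoint_fun (\<lambda>\<alpha>. - B \<alpha>)" and AB: "A 1 \<le> B 1"
  shows "\<exists>\<nu>. \<forall>\<alpha>\<in>{0..1}. level \<nu> \<alpha> = {A \<alpha>..B \<alpha>}"
proof -
  \<comment> \<open>\<open>Sup (insert 0 _)\<close>: the membership is 0 where no level interval contains \<open>t\<close>.\<close>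
  define S where "S t = {\<alpha>\<in>{0..1}. A \<alpha> \<le> t \<and> t \<le> B \<alpha>}" for t
  define \<mu> where "\<mu> t = Sup (insert 0 (S t))" for t
  have bdd: "bdd_above (insert 0 (S t))" for t
    by (rule bdd_aboveI[of _ 1]) (auto simp: S_def)
  have S_le: "\<alpha> \<le> \<mu> t" if "\<alpha> \<in> S t" for \<alpha> t
    unfolding \<mu>_def using that by (intro cSup_upper bdd) auto
  have range: "0 \<le> \<mu> t" "\<mu> t \<le> 1" for t
    unfolding \<mu>_def by (intro cSup_upper bdd insertI1) (rule cSup_least, auto simp: S_def)
  have S_less: "\<beta> \<in> S t" if \<beta>: "0 \<le> \<beta>" "\<beta> < \<mu> t" for \<beta> t
  proof -
    obtain \<alpha> where "\<alpha> \<in> insert 0 (S t)" "\<beta> < \<alpha>"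
      using \<beta>(2) less_cSup_iff[OF _ bdd] unfolding \<mu>_def by blast
    then have "\<alpha> \<in> S t" using \<beta>(1) by auto
    with \<open>\<beta> < \<alpha>\<close> \<beta> show ?thesis
      using endpoint_funD(1)[OF A, of \<beta> \<alpha>] endpoint_funD(1)[OF B, of \<beta> \<alpha>]
      by (auto simp: S_def)
  qed
  \<comment> \<open>The supremum is attained. Positivity of the level matters:
    \<open>0 \<le> \<mu> t\<close> holds everywhere, while \<open>0 \<in> S t\<close> fails outside
    \<open>{A 0..B 0}\<close>.\<close>
  have S_iff: "\<alpha> \<in> S t \<longleftrightarrow> \<alpha> \<le> \<mu> t" if "0 < \<alpha>" for \<alpha> t
  proof
    assume le: "\<alpha> \<le> \<mu> t"
    have "\<alpha> \<le> 1" using le range(2) order_trans by blast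
    have "A \<beta> \<le> t" "- B \<beta> \<le> - t" if "0 < \<beta>" "\<beta> < \<alpha>" for \<beta>
      using S_less[of \<beta> t] that le by (auto simp: S_def)
    then have "A \<alpha> \<le> t" "- B \<alpha> \<le> - t"
      using endpoint_fun_le_at_limit[OF A \<open>0 < \<alpha>\<close> \<open>\<alpha> \<le> 1\<close>]
        endpoint_fun_le_at_limit[OF B \<open>0 < \<alpha>\<close> \<open>\<alpha> \<le> 1\<close>] by blast+
    then show "\<alpha> \<in> S t" using \<open>0 < \<alpha>\<close> \<open>\<alpha> \<le> 1\<close> by (auto simp: S_def)
  qed (rule S_le)
  have pos_level: "{t. \<alpha> \<le> \<mu> t} = {A \<alpha>..B \<alpha>}" if "0 < \<alpha>" "\<alpha> \<le> 1" for \<alpha>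
    unfolding S_iff[OF that(1), symmetric] using that by (auto simp: S_def)
  have supp: "{t. 0 < \<mu> t} \<subseteq> {A 0..B 0}"
    using S_less[of 0] by (auto simp: S_def)
  then have supp': "closure {t. 0 < \<mu> t} \<subseteq> {A 0..B 0}"
    by (rule closure_minimal) simp
  have "is_fuzzy_number \<mu>"
    unfolding is_fuzzy_number_def
  proof (intro conjI allI ballI)
    have "A 1 \<in> {t. 1 \<le> \<mu> t}" using AB by (subst pos_level) auto
    then show "\<exists>t. \<mu> t = 1" using range(2) by (auto intro: antisym)
  next
    fix s t l :: real assume l: "l \<in> {0..1}"
    \<comment> \<open>Both points lie in the interval of level \<open>?a\<close>, and intervals are
      convex. At \<open>?a = 0\<close>, where \<open>pos_level\<close> does not apply, the
      inequality is just nonnegativity.\<close>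
    let ?a = "min (\<mu> s) (\<mu> t)"
    show "?a \<le> \<mu> (l * s + (1 - l) * t)"
    proof (cases "?a = 0")
      case False
      then have a: "0 < ?a" "?a \<le> 1"
        using range[of s] range[of t] by (auto simp: min_def)
      have "s \<in> {A ?a..B ?a}" "t \<in> {A ?a..B ?a}"
        unfolding pos_level[OF a, symmetric] by auto
      then have "l *\<^sub>R s + (1 - l) *\<^sub>R t \<in> {A ?a..B ?a}"
        using l by (intro convexD) auto
      then show ?thesis unfolding pos_level[OF a, symmetric] by simp
    qed (simp only: range)
  next
    show "usc \<mu>"
      unfolding usc_def
    proof (intro allI impI)
      fix t y assume "\<mu> t < y"
      show "\<forall>\<^sub>F s in nhds t. \<mu> s < y"
      proof (cases "y \<le> 1")
        case True
        then have "{s. y \<le> \<mu> s} = {A y..B y}"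
          using \<open>\<mu> t < y\<close> range(1)[of t] by (intro pos_level) auto
        then have "open (- {s. y \<le> \<mu> s})" by (simp add: open_Compl)
        then show ?thesis using \<open>\<mu> t < y\<close>
          by (auto simp: eventually_nhds intro!: exI[of _ "- {s. y \<le> \<mu> s}"])
      next
        case False
        then have "\<mu> s < y" for s using range(2)[of s] by linarith
        then show ?thesis by simp
      qed
    qed
    show "compact (closure {t. 0 < \<mu> t})"
      using supp' bounded_subset[OF bounded_closed_interval]
      by (simp add: compact_eq_bounded_closed)
  qed (rule range)+
  then have m: "membership (Abs_fuzzy \<mu>) = \<mu>" by (simp add: Abs_fuzzy_inverse)
  have "level (Abs_fuzzy \<mu>) \<alpha> = {A \<alpha>..B \<alpha>}" if "\<alpha> \<in> {0..1}" for \<alpha>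
  proof (cases "\<alpha> = 0")
    case False
    then show ?thesis using that pos_level[of \<alpha>] by (simp add: level_def m)
  next
    case True
    let ?C = "level (Abs_fuzzy \<mu>) 0"
    have C: "?C = closure {t. 0 < \<mu> t}" by (simp add: level_def m)
    \<comment> \<open>Level 0 is a closure, so \<open>A 0\<close> and \<open>B 0\<close> are reached
      as limits of the ends of intervals at small positive levels, which lie in the support.\<close>
    have ends: "A \<beta> \<in> ?C" "B \<beta> \<in> ?C" if "0 < \<beta>" "\<beta> < 1" for \<beta>
    proof -
      have "A \<beta> \<le> B \<beta>"
        using endpoint_funD(1)[OF A, of \<beta> 1] endpoint_funD(1)[OF B, of \<beta> 1] AB that by linarith
      then have "A \<beta> \<in> {t. \<beta> \<le> \<mu> t}" "B \<beta> \<in> {t. \<beta> \<le> \<mu> t}"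
        using that by (simp_all only: pos_level) auto
      then have "A \<beta> \<in> {t. 0 < \<mu> t}" "B \<beta> \<in> {t. 0 < \<mu> t}" using that by auto
      then show "A \<beta> \<in> ?C" "B \<beta> \<in> ?C"
        unfolding C by - (erule subsetD[OF closure_subset])+
    qed
    have ev: "\<forall>\<^sub>F \<beta> in at_right 0. 0 < \<beta> \<and> \<beta> < (1::real)"
      using eventually_at_right_real[of 0 1] by simp
    have cl: "closed ?C" by (intro compact_imp_closed compact_level) simp
    have "A 0 \<in> ?C"
      by (rule Lim_in_closed_set[OF cl eventually_mono[OF ev] _ endpoint_funD(3)[OF A]])
        (auto intro: ends)
    moreover have "(B \<longlongrightarrow> B 0) (at_right 0)"
      using tendsto_minus[OF endpoint_funD(3)[OF B]] by simp
    then have "B 0 \<in> ?C"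
      by (rule Lim_in_closed_set[OF cl eventually_mono[OF ev], rotated 2]) (auto intro: ends)
    ultimately have "{A 0..B 0} \<subseteq> ?C" using level_eq[of 0 "Abs_fuzzy \<mu>"] by auto
    with supp' True show ?thesis by (auto simp: C)
  qed
  then show ?thesis by blast
qed

lemma lo_hi_of_level:
  assumes "level \<nu> \<alpha> = {a..b}" "\<alpha> \<in> {0..1}"
  shows "lo \<nu> \<alpha> = a" "hi \<nu> \<alpha> = b"
  using assms level_nonempty[OF assms(2), of \<nu>] by (auto simp: lo_def hi_def)

text \<open>\<open>fuzzy_of_levels\<close> is a definite description; the existence result above is
  what gives it a known value for these levels.\<close>

lemma lo_hi_fuzzy_of_levels:
  assumes "endpoint_fun A" "endpoint_fun (\<lambda>\<alpha>. - B \<alpha>)" "A 1 \<le> B 1"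
    and L: "\<And>\<alpha>. \<alpha> \<in> {0..1} \<Longrightarrow> L \<alpha> = {A \<alpha>..B \<alpha>}" and "\<alpha> \<in> {0..1}"
  shows "lo (fuzzy_of_levels L) \<alpha> = A \<alpha>" "hi (fuzzy_of_levels L) \<alpha> = B \<alpha>"
proof -
  obtain \<nu> where \<nu>: "\<And>\<alpha>. \<alpha> \<in> {0..1} \<Longrightarrow> level \<nu> \<alpha> = {A \<alpha>..B \<alpha>}"
    using ex_fuzzy_of_endpoints[OF assms(1-3)] by blast
  then have "fuzzy_of_levels L = \<nu>" using L by (intro fuzzy_of_levels_eqI) simp
  then show "lo (fuzzy_of_levels L) \<alpha> = A \<alpha>" "hi (fuzzy_of_levels L) \<alpha> = B \<alpha>"
    using lo_hi_of_level[OF \<nu>] assms(5) by auto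
qed

section \<open>Endpoints of a given fuzzy number: monotonicity and one-sided limits\<close>

lemma level_antimono:
  assumes "0 \<le> \<alpha>" "\<alpha> \<le> \<beta>" "\<beta> \<le> 1"
  shows "level \<mu> \<beta> \<subseteq> level \<mu> \<alpha>"
proof (cases "\<alpha> = 0")
  case True
  then show ?thesis using level_subset_0[of \<beta> \<mu>] assms by simp
next
  case False
  then show ?thesis using assms by (auto simp: level_def)
qed

lemma lo_hi_mono:
  assumes "0 \<le> \<alpha>" "\<alpha> \<le> \<beta>" "\<beta> \<le> 1"
  shows "lo \<mu> \<alpha> \<le> lo \<mu> \<beta>" "hi \<mu> \<beta> \<le> hi \<mu> \<alpha>"
  using level_antimono[OF assms, of \<mu>] level_eq[of \<alpha> \<mu>] level_eq[of \<beta> \<mu>]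
    endpoints_in_level_0(2)[of \<beta> \<mu>] assms by auto

text \<open>Exclusion means \<open>membership \<mu> t < \<alpha>\<close> strictly, so every positive
  level between the two still excludes \<open>t\<close>.\<close>

lemma not_in_level_eventually:
  assumes "t \<notin> level \<mu> \<alpha>" "0 < \<alpha>"
  shows "\<forall>\<^sub>F \<beta> in at_left \<alpha>. 0 < \<beta> \<and> \<beta> < \<alpha> \<and> t \<notin> level \<mu> \<beta>"
proof -
  have "max 0 (membership \<mu> t) < \<alpha>" using assms by (auto simp: level_def)
  from eventually_at_left_real[OF this] show ?thesis
    by eventually_elim (auto simp: level_def)
qed

text \<open>An open set that meets the closure of the support meets the support itself, and a point
  of the support belongs to all small positive levels.\<close>

lemma open_meets_level_eventually:
  assumes "open U" "U \<inter> level \<mu> 0 \<noteq> {}"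
  shows "\<forall>\<^sub>F \<beta> in at_right 0. 0 < \<beta> \<and> \<beta> < 1 \<and> U \<inter> level \<mu> \<beta> \<noteq> {}"
proof -
  obtain t where t: "t \<in> U" "0 < membership \<mu> t"
    using assms open_Int_closure_eq_empty[OF assms(1)] by (auto simp: level_def)
  have "0 < min 1 (membership \<mu> t)" using t by simp
  from eventually_at_right_real[OF this] show ?thesis
    by eventually_elim (use t in \<open>auto simp: level_def\<close>)
qed

text \<open>Monotonicity settles one side of each limit. The other side comes from
  \<open>not_in_level_eventually\<close> at positive levels and from
  \<open>open_meets_level_eventually\<close> at level 0.\<close>

lemma endpoint_fun_lo: "endpoint_fun (lo \<mu>)"
  unfolding endpoint_fun_def
proof (intro conjI ballI)
  show "mono_on {0..1} (lo \<mu>)" by (auto simp: mono_on_def lo_hi_mono)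
  show "(lo \<mu> \<longlongrightarrow> lo \<mu> \<alpha>) (at_left \<alpha>)" if "\<alpha> \<in> {0<..1}" for \<alpha>
  proof (rule order_tendstoI)
    fix t assume t: "t < lo \<mu> \<alpha>"
    then have "t \<notin> level \<mu> \<alpha>" using that by (subst level_eq) auto
    from not_in_level_eventually[OF this] that
    have "\<forall>\<^sub>F \<beta> in at_left \<alpha>. 0 < \<beta> \<and> \<beta> < \<alpha> \<and> t \<notin> level \<mu> \<beta>" by simp
    then show "\<forall>\<^sub>F \<beta> in at_left \<alpha>. t < lo \<mu> \<beta>"
    proof eventually_elim
      case (elim \<beta>)
      \<comment> \<open>The point \<open>t\<close> lies outside the interval of level
        \<open>\<beta>\<close>, but not above it, since \<open>t < lo \<mu> \<alpha> \<le> hi \<mu>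
        \<alpha> \<le> hi \<mu> \<beta>\<close>; hence it lies below.\<close>
      then show ?case
        using level_eq[of \<beta> \<mu>] t that lo_hi_mono(2)[of \<beta> \<alpha> \<mu>] endpoints_in_level_0(2)[of \<alpha> \<mu>]
        by auto
    qed
  next
    fix t assume t: "lo \<mu> \<alpha> < t"
    have "\<forall>\<^sub>F \<beta> in at_left \<alpha>. \<beta> \<in> {0<..<\<alpha>}" using that by (intro eventually_at_left_real) auto
    then show "\<forall>\<^sub>F \<beta> in at_left \<alpha>. lo \<mu> \<beta> < t"
    proof eventually_elim
      case (elim \<beta>)
      then show ?case using lo_hi_mono(1)[of \<beta> \<alpha> \<mu>] t that by auto
    qed
  qed
  show "(lo \<mu> \<longlongrightarrow> lo \<mu> 0) (at_right 0)"
  proof (rule order_tendstoI)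
    fix t assume t: "t < lo \<mu> 0"
    have "\<forall>\<^sub>F \<beta> in at_right 0. \<beta> \<in> {0<..<1::real}" by (intro eventually_at_right_real) auto
    then show "\<forall>\<^sub>F \<beta> in at_right 0. t < lo \<mu> \<beta>"
    proof eventually_elim
      case (elim \<beta>)
      then show ?case using lo_hi_mono(1)[of 0 \<beta> \<mu>] t by auto
    qed
  next
    fix t assume t: "lo \<mu> 0 < t"
    then have "{..<t} \<inter> level \<mu> 0 \<noteq> {}"
      using level_eq[of 0 \<mu>] endpoints_in_level_0(2)[of 0 \<mu>] by force
    then have "\<forall>\<^sub>F \<beta> in at_right 0. 0 < \<beta> \<and> \<beta> < 1 \<and> {..<t} \<inter> level \<mu> \<beta> \<noteq> {}"
      by (intro open_meets_level_eventually) auto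
    then show "\<forall>\<^sub>F \<beta> in at_right 0. lo \<mu> \<beta> < t"
      by eventually_elim (auto simp: level_eq)
  qed
qed

lemma endpoint_fun_hi: "endpoint_fun (\<lambda>\<alpha>. - hi \<mu> \<alpha>)"
  unfolding endpoint_fun_def
proof (intro conjI ballI tendsto_minus)
  show "mono_on {0..1} (\<lambda>\<alpha>. - hi \<mu> \<alpha>)" by (auto simp: mono_on_def lo_hi_mono)
  show "(hi \<mu> \<longlongrightarrow> hi \<mu> \<alpha>) (at_left \<alpha>)" if "\<alpha> \<in> {0<..1}" for \<alpha>
  proof (rule order_tendstoI)
    fix t assume t: "hi \<mu> \<alpha> < t"
    then have "t \<notin> level \<mu> \<alpha>" using that by (subst level_eq) auto
    from not_in_level_eventually[OF this] that
    have "\<forall>\<^sub>F \<beta> in at_left \<alpha>. 0 < \<beta> \<and> \<beta> < \<alpha> \<and> t \<notin> level \<mu> \<beta>" by simp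
    then show "\<forall>\<^sub>F \<beta> in at_left \<alpha>. hi \<mu> \<beta> < t"
    proof eventually_elim
      case (elim \<beta>)
      then show ?case
        using level_eq[of \<beta> \<mu>] t that lo_hi_mono(1)[of \<beta> \<alpha> \<mu>] endpoints_in_level_0(2)[of \<alpha> \<mu>]
        by auto
    qed
  next
    fix t assume t: "t < hi \<mu> \<alpha>"
    have "\<forall>\<^sub>F \<beta> in at_left \<alpha>. \<beta> \<in> {0<..<\<alpha>}" using that by (intro eventually_at_left_real) auto
    then show "\<forall>\<^sub>F \<beta> in at_left \<alpha>. t < hi \<mu> \<beta>"
    proof eventually_elim
      case (elim \<beta>)
      then show ?case using lo_hi_mono(2)[of \<beta> \<alpha> \<mu>] t that by auto
    qed
  qed
  show "(hi \<mu> \<longlongrightarrow> hi \<mu> 0) (at_right 0)"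
  proof (rule order_tendstoI)
    fix t assume t: "hi \<mu> 0 < t"
    have "\<forall>\<^sub>F \<beta> in at_right 0. \<beta> \<in> {0<..<1::real}" by (intro eventually_at_right_real) auto
    then show "\<forall>\<^sub>F \<beta> in at_right 0. hi \<mu> \<beta> < t"
    proof eventually_elim
      case (elim \<beta>)
      then show ?case using lo_hi_mono(2)[of 0 \<beta> \<mu>] t by auto
    qed
  next
    fix t assume t: "t < hi \<mu> 0"
    then have "{t<..} \<inter> level \<mu> 0 \<noteq> {}"
      using level_eq[of 0 \<mu>] endpoints_in_level_0(2)[of 0 \<mu>] by force
    then have "\<forall>\<^sub>F \<beta> in at_right 0. 0 < \<beta> \<and> \<beta> < 1 \<and> {t<..} \<inter> level \<mu> \<beta> \<noteq> {}"
      by (intro open_meets_level_eventually) auto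
    then show "\<forall>\<^sub>F \<beta> in at_right 0. t < hi \<mu> \<beta>"
      by eventually_elim (auto simp: level_eq)
  qed
qed

text \<open>A negative factor would swap the endpoints. The factors in the Fejer mean, kernel values
  and \<open>1 / (4 * pi\<^sup>2)\<close>, are nonnegative.\<close>

lemma lo_hi_fscale:
  assumes "0 \<le> k" "\<alpha> \<in> {0..1}"
  shows "lo (fscale k \<mu>) \<alpha> = k * lo \<mu> \<alpha>" "hi (fscale k \<mu>) \<alpha> = k * hi \<mu> \<alpha>"
proof -
  have A: "endpoint_fun (\<lambda>\<alpha>. k * lo \<mu> \<alpha>)" "endpoint_fun (\<lambda>\<alpha>. - (k * hi \<mu> \<alpha>))"
    using endpoint_fun_mult[OF endpoint_fun_lo assms(1)] endpoint_fun_mult[OF endpoint_fun_hi assms(1)]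
    by simp_all
  have B: "k * lo \<mu> 1 \<le> k * hi \<mu> 1"
    using assms(1) endpoints_in_level_0(2)[of 1 \<mu>] by (simp add: mult_left_mono)
  have C: "(*) k ` level \<mu> \<alpha> = {k * lo \<mu> \<alpha>..k * hi \<mu> \<alpha>}" if "\<alpha> \<in> {0..1}" for \<alpha>
    using level_eq[OF that, of \<mu>] endpoints_in_level_0(2)[OF that, of \<mu>] assms(1)
    by (auto simp: image_mult_atLeastAtMost_if)
  show "lo (fscale k \<mu>) \<alpha> = k * lo \<mu> \<alpha>" "hi (fscale k \<mu>) \<alpha> = k * hi \<mu> \<alpha>"
    unfolding fscale_def by (rule lo_hi_fuzzy_of_levels[OF A B C assms(2)]; assumption)+
qed

section \<open>Endpoints of integrals\<close>

text \<open>Monotonicity traps \<open>h p \<alpha>\<close> between \<open>h p 0\<close> and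
  \<open>h p 1\<close>, which yields an integrable majorant common to all levels. The one-sided
  limits are tested along sequences so that dominated convergence applies.\<close>

lemma endpoint_fun_integral:
  fixes h :: "'a::euclidean_space \<Rightarrow> real \<Rightarrow> real"
  assumes h: "\<And>p. p \<in> cbox a b \<Longrightarrow> endpoint_fun (h p)"
    and cont: "\<And>\<alpha>. \<alpha> \<in> {0..1} \<Longrightarrow> continuous_on (cbox a b) (\<lambda>p. h p \<alpha>)"
  shows "endpoint_fun (\<lambda>\<alpha>. integral (cbox a b) (\<lambda>p. h p \<alpha>))"
proof -
  have int: "(\<lambda>p. h p \<alpha>) integrable_on cbox a b" if "\<alpha> \<in> {0..1}" for \<alpha>
    by (rule integrable_continuous[OF cont[OF that]])
  have dom: "norm (h p \<alpha>) \<le> \<bar>h p 0\<bar> + \<bar>h p 1\<bar>" if "p \<in> cbox a b" "\<alpha> \<in> {0..1}" for p \<alpha>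
    using endpoint_funD(1)[OF h[OF that(1)], of 0 \<alpha>] endpoint_funD(1)[OF h[OF that(1)], of \<alpha> 1] that
    by auto
  have int_dom: "(\<lambda>p. \<bar>h p 0\<bar> + \<bar>h p 1\<bar>) integrable_on cbox a b"
    by (intro integrable_continuous continuous_intros cont) auto
  have conv: "(\<lambda>n. integral (cbox a b) (\<lambda>p. h p (s n))) \<longlonglongrightarrow> integral (cbox a b) (\<lambda>p. h p \<alpha>)"
    if s: "\<And>n. s n \<in> {0..1}" and lim: "\<And>p. p \<in> cbox a b \<Longrightarrow> (\<lambda>n. h p (s n)) \<longlonglongrightarrow> h p \<alpha>" for s \<alpha>
    by (rule dominated_convergence(2)[OF int[OF s] int_dom dom[OF _ s] lim])
  show ?thesis
    unfolding endpoint_fun_def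
  proof (intro conjI ballI)
    show "mono_on {0..1} (\<lambda>\<alpha>. integral (cbox a b) (\<lambda>p. h p \<alpha>))"
      by (auto simp: mono_on_def intro!: integral_le int endpoint_funD(1)[OF h])
    show "((\<lambda>\<alpha>. integral (cbox a b) (\<lambda>p. h p \<alpha>)) \<longlongrightarrow> integral (cbox a b) (\<lambda>p. h p \<alpha>)) (at_left \<alpha>)"
      if \<alpha>: "\<alpha> \<in> {0<..1}" for \<alpha>
    proof (rule tendsto_at_left_sequentially[of 0])
      fix s :: "nat \<Rightarrow> real"
      assume s: "\<And>n. s n < \<alpha>" "\<And>n. 0 < s n" "s \<longlonglongrightarrow> \<alpha>"
      then have "filterlim s (at_left \<alpha>) sequentially"
        by (intro tendsto_imp_filterlim_at_left) auto
      then have "(\<lambda>n. h p (s n)) \<longlonglongrightarrow> h p \<alpha>" if "p \<in> cbox a b" for p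
        using endpoint_funD(2)[OF h[OF that], of \<alpha>] \<alpha> by (auto intro: filterlim_compose)
      moreover have "s n \<in> {0..1}" for n using s(1,2)[of n] \<alpha> by auto
      ultimately show "(\<lambda>n. integral (cbox a b) (\<lambda>p. h p (s n))) \<longlonglongrightarrow> integral (cbox a b) (\<lambda>p. h p \<alpha>)"
        by (intro conv)
    qed (use \<alpha> in auto)
    show "((\<lambda>\<alpha>. integral (cbox a b) (\<lambda>p. h p \<alpha>)) \<longlongrightarrow> integral (cbox a b) (\<lambda>p. h p 0)) (at_right 0)"
    proof (rule tendsto_at_right_sequentially[of 0 1])
      fix s :: "nat \<Rightarrow> real"
      assume s: "\<And>n. 0 < s n" "\<And>n. s n < 1" "s \<longlonglongrightarrow> 0"
      then have "filterlim s (at_right 0) sequentially"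
        by (intro tendsto_imp_filterlim_at_right) auto
      then have "(\<lambda>n. h p (s n)) \<longlonglongrightarrow> h p 0" if "p \<in> cbox a b" for p
        using endpoint_funD(3)[OF h[OF that]] by (auto intro: filterlim_compose)
      moreover have "s n \<in> {0..1}" for n using s(1,2)[of n] by auto
      ultimately show "(\<lambda>n. integral (cbox a b) (\<lambda>p. h p (s n))) \<longlonglongrightarrow> integral (cbox a b) (\<lambda>p. h p 0)"
        by (intro conv)
    qed auto
  qed
qed

text \<open>The pairs are \<open>(y, x)\<close> because \<open>fuzzy_integral2\<close> integrates over \<open>x\<close> first.\<close>

lemma lo_hi_fuzzy_integral2:
  assumes lo: "\<And>\<alpha>. \<alpha> \<in> {0..1} \<Longrightarrow> continuous_on (cbox (c, a) (d, b)) (\<lambda>(y, x). lo (g x y) \<alpha>)"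
    and hi: "\<And>\<alpha>. \<alpha> \<in> {0..1} \<Longrightarrow> continuous_on (cbox (c, a) (d, b)) (\<lambda>(y, x). hi (g x y) \<alpha>)"
    and \<alpha>: "\<alpha> \<in> {0..1}"
  shows "lo (fuzzy_integral2 a b c d g) \<alpha> = integral (cbox (c, a) (d, b)) (\<lambda>(y, x). lo (g x y) \<alpha>)"
    and "hi (fuzzy_integral2 a b c d g) \<alpha> = integral (cbox (c, a) (d, b)) (\<lambda>(y, x). hi (g x y) \<alpha>)"
proof -
  let ?Q = "cbox (c, a) (d, b)"
  note lo' = lo[unfolded case_prod_beta] and hi' = hi[unfolded case_prod_beta]
  have A: "endpoint_fun (\<lambda>\<alpha>. integral ?Q (\<lambda>p. lo (g (snd p) (fst p)) \<alpha>))"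
    by (intro endpoint_fun_integral endpoint_fun_lo lo')
  have "endpoint_fun (\<lambda>\<alpha>. integral ?Q (\<lambda>p. - hi (g (snd p) (fst p)) \<alpha>))"
    by (intro endpoint_fun_integral endpoint_fun_hi continuous_on_minus hi')
  then have B: "endpoint_fun (\<lambda>\<alpha>. - integral ?Q (\<lambda>p. hi (g (snd p) (fst p)) \<alpha>))"
    by simp
  have C: "integral ?Q (\<lambda>p. lo (g (snd p) (fst p)) 1) \<le> integral ?Q (\<lambda>p. hi (g (snd p) (fst p)) 1)"
    by (intro integral_le integrable_continuous lo' hi' endpoints_in_level_0) auto
  \<comment> \<open>Fubini for continuous integrands turns the iterated integrals into integrals
    over the rectangle, the form in which \<open>A\<close> and \<open>B\<close> are stated.\<close>
  have D: "{integral {c..d} (\<lambda>y. integral {a..b} (\<lambda>x. lo (g x y) \<alpha>)) ..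
      integral {c..d} (\<lambda>y. integral {a..b} (\<lambda>x. hi (g x y) \<alpha>))} =
      {integral ?Q (\<lambda>p. lo (g (snd p) (fst p)) \<alpha>)..integral ?Q (\<lambda>p. hi (g (snd p) (fst p)) \<alpha>)}"
    if "\<alpha> \<in> {0..1}" for \<alpha>
    using integral_prod_continuous[OF lo'[OF that]] integral_prod_continuous[OF hi'[OF that]] by simp
  show "lo (fuzzy_integral2 a b c d g) \<alpha> = integral ?Q (\<lambda>(y, x). lo (g x y) \<alpha>)"
    and "hi (fuzzy_integral2 a b c d g) \<alpha> = integral ?Q (\<lambda>(y, x). hi (g x y) \<alpha>)"
    unfolding fuzzy_integral2_def case_prod_beta
    by (rule lo_hi_fuzzy_of_levels[OF A B C D \<alpha>]; assumption)+
qed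

section \<open>Moduli of periodic fuzzy valued functions\<close>

text \<open>Heine-Cantor on a compact box; translating a close pair of points by a common period
  vector brings both into the box without changing the values of \<open>f\<close>.\<close>

lemma uniformly_continuous_C_2pi_fuzzy:
  assumes "f \<in> C_2pi_fuzzy"
  shows "uniformly_continuous_on UNIV f"
  unfolding uniformly_continuous_on_def
proof (intro allI impI ballI)
  fix e :: real assume "0 < e"
  \<comment> \<open>The margin 1 around the period square keeps the second point of the pair in the
    box once the first has been moved into the square.\<close>
  let ?K = "cbox (- 1, - 1) (2 * pi + 1, 2 * pi + 1)"
  have "uniformly_continuous_on ?K f"
    using assms by (intro compact_uniformly_continuous)
      (auto simp: C_2pi_fuzzy_def intro: continuous_on_subset)
  with \<open>0 < e\<close> obtain d where d: "0 < d"
    "\<And>p q. p \<in> ?K \<Longrightarrow> q \<in> ?K \<Longrightarrow> dist q p < d \<Longrightarrow> dist (f q) (f p) < e"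
    unfolding uniformly_continuous_on_def by blast
  have red: "\<exists>n::int. x + 2 * of_int n * pi \<in> {0..2 * pi}" for x :: real
  proof
    have "of_int \<lfloor>x / (2 * pi)\<rfloor> * (2 * pi) \<le> x" "x < (of_int \<lfloor>x / (2 * pi)\<rfloor> + 1) * (2 * pi)"
      by (simp_all add: floor_divide_lower floor_divide_upper)
    then show "x + 2 * of_int (- \<lfloor>x / (2 * pi)\<rfloor>) * pi \<in> {0..2 * pi}"
      by (simp add: algebra_simps)
  qed
  have "dist (f q) (f p) < e" if "dist q p < min d 1" for p q
  proof -
    obtain m where m: "fst p + 2 * of_int m * pi \<in> {0..2 * pi}" using red by blast
    obtain n where n: "snd p + 2 * of_int n * pi \<in> {0..2 * pi}" using red by blast
    define w where "w = (2 * of_int m * pi, 2 * of_int n * pi)"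
    have shift: "f (r + w) = f r" for r
    proof (cases r)
      case (Pair u v)
      have "f (u, v) = f (u + 2 * of_int m * pi, v)"
        using assms unfolding C_2pi_fuzzy_def periodic_2pi_def by blast
      also have "\<dots> = f (u + 2 * of_int m * pi, v + 2 * of_int n * pi)"
        using assms unfolding C_2pi_fuzzy_def periodic_2pi_def by blast
      finally show ?thesis by (simp add: Pair w_def)
    qed
    have "\<bar>fst q - fst p\<bar> \<le> 1" "\<bar>snd q - snd p\<bar> \<le> 1"
      using dist_fst_le[of q p] dist_snd_le[of q p] that by (auto simp: dist_real_def)
    then have "p + w \<in> ?K" "q + w \<in> ?K"
      using m n by (auto simp: w_def cbox_Pair_iff mem_Times_iff cbox_Pair_eq)
    moreover have "dist (q + w) (p + w) < d" using that by simp
    ultimately have "dist (f (q + w)) (f (p + w)) < e" by (rule d(2))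
    then show ?thesis by (simp add: shift)
  qed
  then show "\<exists>d>0. \<forall>p\<in>UNIV. \<forall>q\<in>UNIV. dist q p < d \<longrightarrow> dist (f q) (f p) < e"
    using \<open>0 < d\<close> by (intro exI[of _ "min d 1"]) auto
qed

text \<open>A Korovkin-type bound: uniform continuity covers small \<open>x\<close> and
  \<open>y\<close>, and otherwise a sine square is bounded below, so a multiple of it exceeds the
  diameter of the range. Sine squares are used because they cancel the denominator of the Fejer
  kernel.\<close>

lemma C_2pi_fuzzy_dist_bound:
  assumes f: "f \<in> C_2pi_fuzzy" and "0 < e"
  shows "\<exists>C\<ge>0. \<forall>u v x y. \<bar>x\<bar> \<le> pi \<longrightarrow> \<bar>y\<bar> \<le> pi \<longrightarrow>
    dist (f (u - x, v - y)) (f (u, v)) \<le> e + C * ((sin (x / 2))\<^sup>2 + (sin (y / 2))\<^sup>2)"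
proof -
  define M where "M = diameter (range f)"
  have M: "dist (f p) (f q) \<le> M" for p q
    unfolding M_def by (intro diameter_bounded_bound bounded_C_2pi_fuzzy f) auto
  have "0 \<le> M" using M[of 0 0] by simp
  obtain d where d: "0 < d" "\<And>p q. dist q p < d \<Longrightarrow> dist (f q) (f p) < e"
    using uniformly_continuous_C_2pi_fuzzy[OF f] \<open>0 < e\<close>
    unfolding uniformly_continuous_on_def by blast
  \<comment> \<open>Scaled so that \<open>C * (sin (x / 2))\<^sup>2\<close> reaches \<open>M\<close>
    at \<open>\<bar>x\<bar> = d / 2\<close>. If \<open>sin (d / 4) = 0\<close>, then
    \<open>C\<close> is 0 by the convention on division; this is harmless, since
    \<open>d / 2\<close> then exceeds \<open>pi\<close>.\<close>
  define C where "C = M / (sin (d / 4))\<^sup>2"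
  have "0 \<le> C" using \<open>0 \<le> M\<close> by (simp add: C_def)
  have far: "M \<le> C * (sin (x / 2))\<^sup>2" if "d / 2 \<le> \<bar>x\<bar>" "\<bar>x\<bar> \<le> pi" for x
  proof -
    have pos: "0 < sin (d / 4)" using d(1) that by (intro sin_gt_zero) auto
    have "sin (d / 4) \<le> sin (\<bar>x\<bar> / 2)"
      using that d(1) by (intro sin_monotone_2pi_le) auto
    then have "(sin (d / 4))\<^sup>2 \<le> (sin (\<bar>x\<bar> / 2))\<^sup>2"
      using pos by (intro power_mono) auto
    also have "\<dots> = (sin (x / 2))\<^sup>2" by (simp add: abs_if)
    finally have "C * (sin (d / 4))\<^sup>2 \<le> C * (sin (x / 2))\<^sup>2"
      using \<open>0 \<le> C\<close> by (rule mult_left_mono)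
    then show ?thesis using pos by (simp add: C_def)
  qed
  have "dist (f (u - x, v - y)) (f (u, v)) \<le> e + C * ((sin (x / 2))\<^sup>2 + (sin (y / 2))\<^sup>2)"
    if "\<bar>x\<bar> \<le> pi" "\<bar>y\<bar> \<le> pi" for u v x y
  proof (cases "\<bar>x\<bar> < d / 2 \<and> \<bar>y\<bar> < d / 2")
    case True
    have "dist (u - x, v - y) (u, v) \<le> \<bar>x\<bar> + \<bar>y\<bar>"
      using sqrt_sum_squares_le_sum_abs[of x y] by (simp add: dist_Pair_Pair dist_real_def)
    then have "dist (f (u - x, v - y)) (f (u, v)) < e" using True by (intro d(2)) auto
    moreover have "0 \<le> C * ((sin (x / 2))\<^sup>2 + (sin (y / 2))\<^sup>2)"
      using \<open>0 \<le> C\<close> by simp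
    ultimately show ?thesis by linarith
  next
    case False
    have "0 \<le> C * (sin (x / 2))\<^sup>2" "0 \<le> C * (sin (y / 2))\<^sup>2" using \<open>0 \<le> C\<close> by simp_all
    then have "M \<le> C * (sin (x / 2))\<^sup>2 + C * (sin (y / 2))\<^sup>2"
      using False far[of x] far[of y] that by (auto simp: not_less)
    then show ?thesis
      using M[of "(u - x, v - y)" "(u, v)"] \<open>0 < e\<close> unfolding distrib_left by linarith
  qed
  then show ?thesis using \<open>0 \<le> C\<close> by blast
qed

section \<open>The Fejer kernel\<close>

text \<open>Written as a trigonometric polynomial rather than a quotient of sines: continuity and
  term-by-term integration then need no case split at multiples of \<open>2 * pi\<close>.\<close>

definition dirichlet_kernel :: "nat \<Rightarrow> real \<Rightarrow> real" where
  "dirichlet_kernel j u = 1 + 2 * (\<Sum>k=1..j. cos (real k * u))"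

text \<open>Telescoping: \<open>2 * sin (u / 2) * cos (k * u)\<close> is the difference of the sines
  of \<open>k * u + u / 2\<close> and \<open>k * u - u / 2\<close>. The product form also covers
  zeros of \<open>sin (u / 2)\<close>.\<close>

lemma sin_mult_dirichlet_kernel:
  "sin (u / 2) * dirichlet_kernel j u = sin ((2 * real j + 1) * u / 2)"
proof (induction j)
  case (Suc j)
  have e: "(2 * real (Suc j) + 1) * u / 2 = real (Suc j) * u + u / 2"
    "(2 * real j + 1) * u / 2 = real (Suc j) * u - u / 2"
    by (simp_all add: field_simps)
  have "sin ((2 * real (Suc j) + 1) * u / 2) =
      sin ((2 * real j + 1) * u / 2) + 2 * sin (u / 2) * cos (real (Suc j) * u)"
    unfolding e sin_add sin_diff by simp
  then show ?case using Suc by (simp add: dirichlet_kernel_def algebra_simps)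
qed (simp add: dirichlet_kernel_def)

text \<open>A second telescoping sum: with \<open>s = (m + 1) * u / 2\<close>, the new term
  \<open>sin (u / 2) * sin (2 * s + u / 2)\<close> is the increment of the squared sine from
  \<open>s\<close> to \<open>s + u / 2\<close>.\<close>

lemma sin_squared_mult_sum_dirichlet_kernel:
  "(sin (u / 2))\<^sup>2 * (\<Sum>j\<le>m. dirichlet_kernel j u) = (sin ((real m + 1) * u / 2))\<^sup>2"
proof (induction m)
  case (Suc m)
  define s where "s = (real m + 1) * u / 2"
  have e: "(2 * real (Suc m) + 1) * u / 2 = 2 * s + u / 2" "(real (Suc m) + 1) * u / 2 = s + u / 2"
    by (simp_all add: s_def field_simps)
  have "(sin (u / 2))\<^sup>2 * dirichlet_kernel (Suc m) u = sin (u / 2) * sin (2 * s + u / 2)"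
    using sin_mult_dirichlet_kernel[of u "Suc m"] unfolding e by (simp add: power2_eq_square)
  also have "sin (u / 2) * sin (2 * s + u / 2) = (sin (s + u / 2))\<^sup>2 - (sin s)\<^sup>2"
  proof -
    have "(sin (s + u / 2))\<^sup>2 - (sin s)\<^sup>2 = (cos (2 * s) - cos (2 * (s + u / 2))) / 2"
      using cos_double_sin[of s] cos_double_sin[of "s + u / 2"] by simp
    also have "\<dots> = sin (u / 2) * sin (2 * s + u / 2)"
    proof -
      have "(2 * s + 2 * (s + u / 2)) / 2 = 2 * s + u / 2" "(2 * (s + u / 2) - 2 * s) / 2 = u / 2"
        by simp_all
      then show ?thesis by (simp only: cos_diff_cos) simp
    qed
    finally show ?thesis by simp
  qed
  finally show ?case using Suc unfolding e by (simp add: s_def algebra_simps)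
qed (simp add: dirichlet_kernel_def)

text \<open>The Fejer kernel is the mean of the first \<open>m + 1\<close> Dirichlet kernels. At
  multiples of \<open>2 * pi\<close> all cosines are 1 and the sum is one of consecutive odd
  numbers, \<open>(m + 1)\<^sup>2\<close>.\<close>

lemma fejer_kernel_eq: "fejer_kernel m u = (\<Sum>j\<le>m. dirichlet_kernel j u) / (real m + 1)"
proof (cases "\<exists>k::int. u = of_int k * (2 * pi)")
  case True
  then obtain k :: int where k: "u = of_int k * (2 * pi)" ..
  have "cos (real i * u) = 1" for i
    using cos_int_2pin[of "int i * k"] by (simp add: k mult_ac)
  then have "dirichlet_kernel j u = 1 + 2 * real j" for j
    by (simp add: dirichlet_kernel_def)
  moreover have "(\<Sum>j\<le>m. 1 + 2 * real j) = (real m + 1)\<^sup>2"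
    by (induction m) (simp_all add: power2_eq_square algebra_simps)
  ultimately show ?thesis using True by (simp add: fejer_kernel_def power2_eq_square)
next
  case False
  then have "sin (u / 2) \<noteq> 0" by (auto simp: sin_zero_iff_int2)
  then show ?thesis
    using False by (simp add: fejer_kernel_def sin_squared_mult_sum_dirichlet_kernel[symmetric])
qed

lemma continuous_on_fejer_kernel [continuous_intros]:
  fixes g :: "'a::t2_space \<Rightarrow> real"
  assumes "continuous_on S g"
  shows "continuous_on S (\<lambda>x. fejer_kernel m (g x))"
  unfolding fejer_kernel_eq dirichlet_kernel_def by (intro continuous_intros assms) auto

lemma fejer_kernel_nonneg: "0 \<le> fejer_kernel m u"
  by (simp add: fejer_kernel_def)

text \<open>The sine square cancels the denominator of the kernel and leaves a numerator of at most
  1.\<close>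

lemma fejer_kernel_mult_sin_squared_le: "fejer_kernel m u * (sin (u / 2))\<^sup>2 \<le> 1 / (real m + 1)"
proof -
  have "fejer_kernel m u * (sin (u / 2))\<^sup>2 = (sin ((real m + 1) * u / 2))\<^sup>2 / (real m + 1)"
    unfolding sin_squared_mult_sum_dirichlet_kernel[symmetric] fejer_kernel_eq by simp
  also have "\<dots> \<le> 1 / (real m + 1)"
    by (intro divide_right_mono) (auto simp: abs_square_le_1)
  finally show ?thesis .
qed

lemma has_integral_cos_multiple:
  assumes "k > 0"
  shows "((\<lambda>x. cos (real k * x)) has_integral 0) {- pi..pi}"
proof -
  have "((\<lambda>x. cos (real k * x)) has_integral
      (sin (real k * pi) / real k - sin (real k * (- pi)) / real k)) {- pi..pi}"
    using assms by (intro fundamental_theorem_of_calculus)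
      (auto intro!: derivative_eq_intros simp: has_real_derivative_iff_has_vector_derivative[symmetric])
  then show ?thesis by simp
qed

text \<open>Only the constant term 1 of each Dirichlet kernel contributes; the cosines integrate to
  0 over a full period.\<close>

lemma has_integral_fejer_kernel: "(fejer_kernel m has_integral 2 * pi) {- pi..pi}"
proof -
  have "(dirichlet_kernel j has_integral 2 * pi) {- pi..pi}" for j
  proof -
    have "((\<lambda>x. 1 + 2 * (\<Sum>k=1..j. cos (real k * x))) has_integral 2 * pi + 2 * (\<Sum>k=1..j. 0)) {- pi..pi}"
      using has_integral_const_real[of "1::real" "- pi" pi]
      by (intro has_integral_add has_integral_mult_right has_integral_sum has_integral_cos_multiple) auto
    then show ?thesis by (simp add: dirichlet_kernel_def[abs_def])
  qed
  then have "((\<lambda>u. (\<Sum>j\<le>m. dirichlet_kernel j u) / (real m + 1)) has_integral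
      (\<Sum>j\<le>m. 2 * pi) / (real m + 1)) {- pi..pi}"
    by (intro has_integral_divide has_integral_sum) auto
  moreover have "(\<Sum>j\<le>m. 2 * pi) / (real m + 1) = 2 * pi"
    by (simp add: nonzero_divide_eq_eq)
  ultimately show ?thesis by (simp only: fejer_kernel_eq[abs_def])
qed

section \<open>Averages against the product kernel\<close>

lemma integral_prod_mult:
  fixes p q :: "real \<Rightarrow> real"
  assumes "continuous_on {c..d} q" "continuous_on {a..b} p"
  shows "integral (cbox (c, a) (d, b)) (\<lambda>(y, x). p x * q y) = integral {a..b} p * integral {c..d} q"
proof -
  have "continuous_on (cbox (c, a) (d, b)) (\<lambda>(y, x). p x * q y)"
    unfolding case_prod_beta
    by (intro continuous_intros continuous_on_compose2[OF assms(1)] continuous_on_compose2[OF assms(2)])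
      (auto simp: cbox_Pair_eq)
  from integral_prod_continuous[OF this] show ?thesis by simp
qed

text \<open>The product kernel has mass \<open>4 * pi\<^sup>2\<close>, so the difference to
  \<open>c\<close> is the weighted mean of \<open>h - c\<close>, and nonnegativity of the kernel
  lets the pointwise bound be averaged.\<close>

lemma fejer_mean_bound:
  fixes h :: "real \<times> real \<Rightarrow> real"
  defines "Q \<equiv> cbox (- pi, - pi) (pi, pi)"
  assumes cont: "continuous_on Q h"
    and bound: "\<And>x y. \<bar>x\<bar> \<le> pi \<Longrightarrow> \<bar>y\<bar> \<le> pi \<Longrightarrow>
      \<bar>h (y, x) - c\<bar> \<le> e + C * ((sin (x / 2))\<^sup>2 + (sin (y / 2))\<^sup>2)"
    and "0 \<le> C"
  shows "\<bar>1 / (4 * pi\<^sup>2) * integral Q (\<lambda>(y, x). fejer_kernel m x * fejer_kernel n y * h (y, x)) - c\<bar>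
    \<le> e + C * (1 / (real m + 1) + 1 / (real n + 1))"
proof -
  define K where "K = (\<lambda>(y, x). fejer_kernel m x * fejer_kernel n y)"
  have contK: "continuous_on Q K"
    unfolding K_def case_prod_beta by (intro continuous_intros)
  have fej: "integral {- pi..pi} (fejer_kernel i) = 2 * pi" for i
    using has_integral_fejer_kernel by (rule integral_unique)
  have intK: "integral Q K = 4 * pi\<^sup>2"
    unfolding K_def Q_def by (subst integral_prod_mult) (auto simp: fej power2_eq_square intro!: continuous_intros)
  \<comment> \<open>\<open>P1\<close> and \<open>P2\<close> majorize the product kernel times one of
    the sine squares: the matching factor is replaced by its bound, and the other factor is kept.
    Both are products, so their integrals split.\<close>
  define P1 where "P1 = (\<lambda>(y, x::real). 1 / (real m + 1) * fejer_kernel n y)"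
  define P2 where "P2 = (\<lambda>(y::real, x). fejer_kernel m x * (1 / (real n + 1)))"
  define R where "R p = e * K p + C * (P1 p + P2 p)" for p
  have contP: "continuous_on Q P1" "continuous_on Q P2"
    unfolding P1_def P2_def case_prod_beta by (intro continuous_intros)+
  have contR: "continuous_on Q R"
    unfolding R_def by (intro continuous_intros contK contP)
  have intP: "integral Q P1 = 4 * pi\<^sup>2 / (real m + 1)" "integral Q P2 = 4 * pi\<^sup>2 / (real n + 1)"
    unfolding P1_def P2_def Q_def
    by (subst integral_prod_mult; auto simp: fej power2_eq_square intro!: continuous_intros)+
  have integrable: "g integrable_on Q" if "continuous_on Q g" for g :: "real \<times> real \<Rightarrow> real"
    using that unfolding Q_def by (rule integrable_continuous)
  have "(R has_integral e * integral Q K + C * (integral Q P1 + integral Q P2)) Q"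
    unfolding R_def
    by (intro has_integral_add has_integral_mult_right integrable_integral integrable contK contP)
  then have "integral Q R = e * integral Q K + C * (integral Q P1 + integral Q P2)"
    by (rule integral_unique)
  then have intR: "integral Q R = 4 * pi\<^sup>2 * (e + C * (1 / (real m + 1) + 1 / (real n + 1)))"
    by (simp add: intK intP algebra_simps)
  have "\<bar>integral Q (\<lambda>p. K p * (h p - c))\<bar> \<le> integral Q R"
    unfolding real_norm_def[symmetric]
  proof (rule integral_norm_bound_integral)
    fix p assume "p \<in> Q"
    then obtain x y where p: "p = (y, x)" and xy: "\<bar>x\<bar> \<le> pi" "\<bar>y\<bar> \<le> pi"
      by (cases p) (auto simp: Q_def cbox_Pair_eq)
    have K0: "0 \<le> K p" by (simp add: K_def p fejer_kernel_nonneg)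
    have "norm (K p * (h p - c)) \<le> K p * (e + C * ((sin (x / 2))\<^sup>2 + (sin (y / 2))\<^sup>2))"
      using bound[OF xy] K0 by (simp add: abs_mult p mult_left_mono)
    also have "\<dots> = e * K p + C * (fejer_kernel m x * (sin (x / 2))\<^sup>2 * fejer_kernel n y +
        fejer_kernel m x * (fejer_kernel n y * (sin (y / 2))\<^sup>2))"
      by (simp add: K_def p algebra_simps)
    also have "\<dots> \<le> R p"
      unfolding R_def P1_def P2_def p prod.case using \<open>0 \<le> C\<close>
      by (intro add_left_mono mult_left_mono add_mono mult_right_mono
          fejer_kernel_mult_sin_squared_le fejer_kernel_nonneg)
    finally show "norm (K p * (h p - c)) \<le> R p" .
  qed (intro integrable continuous_intros contK cont contR)+
  moreover have "integral Q (\<lambda>p. K p * (h p - c)) = integral Q (\<lambda>p. K p * h p) - 4 * pi\<^sup>2 * c"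
  proof -
    have "integral Q (\<lambda>p. K p * (h p - c)) = integral Q (\<lambda>p. K p * h p) - integral Q (\<lambda>p. K p * c)"
      unfolding right_diff_distrib by (intro integral_diff integrable continuous_intros contK cont)
    then show ?thesis by (simp add: intK)
  qed
  moreover have "(\<lambda>p. K p * h p) = (\<lambda>(y, x). fejer_kernel m x * fejer_kernel n y * h (y, x))"
    by (auto simp: K_def)
  ultimately have "\<bar>integral Q (\<lambda>(y, x). fejer_kernel m x * fejer_kernel n y * h (y, x)) - 4 * pi\<^sup>2 * c\<bar>
      \<le> 4 * pi\<^sup>2 * (e + C * (1 / (real m + 1) + 1 / (real n + 1)))"
    by (simp add: intR)
  moreover have "1 / (4 * pi\<^sup>2) * I - c = (I - 4 * pi\<^sup>2 * c) / (4 * pi\<^sup>2)" for I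
    by (simp add: field_simps)
  ultimately show ?thesis
    by (simp add: abs_divide pos_divide_le_eq mult.commute)
qed

section \<open>Convergence of the Fejer operators\<close>

text \<open>Each endpoint difference at a fixed level is dominated by the supremum defining
  \<open>fuzzy_D\<close>, so the endpoint maps are 1-Lipschitz.\<close>

lemma continuous_on_lo_hi:
  assumes "continuous_on S g" "\<alpha> \<in> {0..1}"
  shows "continuous_on S (\<lambda>p. lo (g p) \<alpha>)" "continuous_on S (\<lambda>p. hi (g p) \<alpha>)"
proof -
  have "1-lipschitz_on UNIV (\<lambda>\<mu>. lo \<mu> \<alpha>)" "1-lipschitz_on UNIV (\<lambda>\<mu>. hi \<mu> \<alpha>)"
    using fuzzy_D_upper[OF assms(2)] by (auto intro!: lipschitz_onI simp: dist_fuzzy_def dist_real_def)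
  then have "continuous_on UNIV (\<lambda>\<mu>. lo \<mu> \<alpha>)" "continuous_on UNIV (\<lambda>\<mu>. hi \<mu> \<alpha>)"
    by (auto intro: lipschitz_on_continuous_on)
  then show "continuous_on S (\<lambda>p. lo (g p) \<alpha>)" "continuous_on S (\<lambda>p. hi (g p) \<alpha>)"
    by (auto intro: continuous_on_compose2 assms(1))
qed

lemma lo_hi_fejer_op:
  fixes f :: "real \<times> real \<Rightarrow> fuzzy"
  defines "Q \<equiv> cbox (- pi, - pi) (pi, pi)"
  assumes f: "continuous_on UNIV f" and \<alpha>: "\<alpha> \<in> {0..1}"
  shows "lo (fejer_op m n f (u, v)) \<alpha> = 1 / (4 * pi\<^sup>2) *
      integral Q (\<lambda>(y, x). fejer_kernel m x * fejer_kernel n y * lo (f (u - x, v - y)) \<alpha>)"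
    and "hi (fejer_op m n f (u, v)) \<alpha> = 1 / (4 * pi\<^sup>2) *
      integral Q (\<lambda>(y, x). fejer_kernel m x * fejer_kernel n y * hi (f (u - x, v - y)) \<alpha>)"
proof -
  let ?g = "\<lambda>x y. fscale (fejer_kernel m x * fejer_kernel n y) (f (u - x, v - y))"
  have k: "0 \<le> fejer_kernel m x * fejer_kernel n y" for x y
    by (simp add: fejer_kernel_nonneg)
  have f': "continuous_on Q (\<lambda>p. f (u - snd p, v - fst p))"
    by (intro continuous_on_compose2[OF f] continuous_intros) auto
  have A: "continuous_on Q (\<lambda>(y, x). lo (?g x y) \<alpha>)" "continuous_on Q (\<lambda>(y, x). hi (?g x y) \<alpha>)"
    if "\<alpha> \<in> {0..1}" for \<alpha>
    unfolding lo_hi_fscale[OF k that] case_prod_beta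
    by (intro continuous_intros continuous_on_lo_hi[OF f' that])+
  have "0 \<le> 1 / (4 * pi\<^sup>2)" by simp
  note s = lo_hi_fscale[OF this \<alpha>]
  have i: "lo (fuzzy_integral2 (- pi) pi (- pi) pi ?g) \<alpha> = integral Q (\<lambda>(y, x). lo (?g x y) \<alpha>)"
    "hi (fuzzy_integral2 (- pi) pi (- pi) pi ?g) \<alpha> = integral Q (\<lambda>(y, x). hi (?g x y) \<alpha>)"
    unfolding Q_def
    by (rule lo_hi_fuzzy_integral2[of _ _ _ _ ?g, OF A[unfolded Q_def] \<alpha>]; assumption)+
  show "lo (fejer_op m n f (u, v)) \<alpha> = 1 / (4 * pi\<^sup>2) *
      integral Q (\<lambda>(y, x). fejer_kernel m x * fejer_kernel n y * lo (f (u - x, v - y)) \<alpha>)"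
    and "hi (fejer_op m n f (u, v)) \<alpha> = 1 / (4 * pi\<^sup>2) *
      integral Q (\<lambda>(y, x). fejer_kernel m x * fejer_kernel n y * hi (f (u - x, v - y)) \<alpha>)"
    unfolding fejer_op_def prod.case s i unfolding lo_hi_fscale[OF k \<alpha>] by (rule refl)+
qed

text \<open>The hypothesis bounds both endpoint differences at every level with the same
  \<open>e\<close> and \<open>C\<close>, so the real estimate is uniform in the level and passes to
  the supremum.\<close>

lemma fuzzy_D_fejer_op_le:
  assumes f: "f \<in> C_2pi_fuzzy" and "0 \<le> C"
    and bound: "\<And>x y. \<bar>x\<bar> \<le> pi \<Longrightarrow> \<bar>y\<bar> \<le> pi \<Longrightarrow>
      dist (f (u - x, v - y)) (f (u, v)) \<le> e + C * ((sin (x / 2))\<^sup>2 + (sin (y / 2))\<^sup>2)"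
  shows "fuzzy_D (fejer_op m n f (u, v)) (f (u, v)) \<le> e + C * (1 / (real m + 1) + 1 / (real n + 1))"
  unfolding fuzzy_D_def
proof (rule cSUP_least)
  fix \<alpha> :: real assume \<alpha>: "\<alpha> \<in> {0..1}"
  let ?Q = "cbox (- pi, - pi) (pi, pi)"
  have cont: "continuous_on UNIV f" using f by (simp add: C_2pi_fuzzy_def)
  have f': "continuous_on ?Q (\<lambda>p. f (u - snd p, v - fst p))"
    by (intro continuous_on_compose2[OF cont] continuous_intros) auto
  have b: "\<bar>lo (f (u - x, v - y)) \<alpha> - lo (f (u, v)) \<alpha>\<bar> \<le> e + C * ((sin (x / 2))\<^sup>2 + (sin (y / 2))\<^sup>2)"
    "\<bar>hi (f (u - x, v - y)) \<alpha> - hi (f (u, v)) \<alpha>\<bar> \<le> e + C * ((sin (x / 2))\<^sup>2 + (sin (y / 2))\<^sup>2)"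
    if "\<bar>x\<bar> \<le> pi" "\<bar>y\<bar> \<le> pi" for x y
    using fuzzy_D_upper[OF \<alpha>, of "f (u - x, v - y)" "f (u, v)"] bound[OF that]
    by (auto simp: dist_fuzzy_def)
  have "\<bar>lo (fejer_op m n f (u, v)) \<alpha> - lo (f (u, v)) \<alpha>\<bar> \<le> e + C * (1 / (real m + 1) + 1 / (real n + 1))"
    using fejer_mean_bound[OF continuous_on_lo_hi(1)[OF f' \<alpha>] _ \<open>0 \<le> C\<close>, of "lo (f (u, v)) \<alpha>" e m n]
      b(1) by (simp add: lo_hi_fejer_op[OF cont \<alpha>])
  moreover have "\<bar>hi (fejer_op m n f (u, v)) \<alpha> - hi (f (u, v)) \<alpha>\<bar> \<le> e + C * (1 / (real m + 1) + 1 / (real n + 1))"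
    using fejer_mean_bound[OF continuous_on_lo_hi(2)[OF f' \<alpha>] _ \<open>0 \<le> C\<close>, of "hi (f (u, v)) \<alpha>" e m n]
      b(2) by (simp add: lo_hi_fejer_op[OF cont \<alpha>])
  ultimately show "max \<bar>lo (fejer_op m n f (u, v)) \<alpha> - lo (f (u, v)) \<alpha>\<bar>
      \<bar>hi (fejer_op m n f (u, v)) \<alpha> - hi (f (u, v)) \<alpha>\<bar> \<le> e + C * (1 / (real m + 1) + 1 / (real n + 1))"
    by simp
qed simp

theorem mainTheorem5:
  fixes f :: "real \<times> real \<Rightarrow> fuzzy"
  assumes "f \<in> C_2pi_fuzzy"
  shows "pringsheim_lim (\<lambda>m n. Dstar (fejer_op m n f) f) 0"
  unfolding pringsheim_lim_def
proof (intro allI impI)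
  fix \<epsilon> :: real assume "0 < \<epsilon>"
  then obtain C where C: "0 \<le> C" "\<And>u v x y. \<bar>x\<bar> \<le> pi \<Longrightarrow> \<bar>y\<bar> \<le> pi \<Longrightarrow>
      dist (f (u - x, v - y)) (f (u, v)) \<le> \<epsilon> / 2 + C * ((sin (x / 2))\<^sup>2 + (sin (y / 2))\<^sup>2)"
    using C_2pi_fuzzy_dist_bound[OF assms, of "\<epsilon> / 2"] by auto
  \<comment> \<open>Chosen so that each of the two kernel terms in \<open>B\<close> stays below
    \<open>\<epsilon> / 4\<close>.\<close>
  obtain N where N: "4 * C / \<epsilon> < real N" using reals_Archimedean2 by blast
  have "\<bar>Dstar (fejer_op m n f) f - 0\<bar> < \<epsilon>" if "N \<le> m" "N \<le> n" for m n
  proof -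
    define B where "B = \<epsilon> / 2 + C * (1 / (real m + 1) + 1 / (real n + 1))"
    have le: "fuzzy_D (fejer_op m n f p) (f p) \<le> B" for p
      unfolding B_def by (cases p) (use fuzzy_D_fejer_op_le[OF assms C] in simp)
    have "Dstar (fejer_op m n f) f \<le> B"
      unfolding Dstar_def using le by (intro cSUP_least) auto
    \<comment> \<open>A real supremum dominates its members only if they are bounded above; the
      common bound \<open>B\<close> ensures this, and the member at the origin is a
      distance.\<close>
    moreover have "0 \<le> Dstar (fejer_op m n f) f"
    proof -
      have "bdd_above (range (\<lambda>p. fuzzy_D (fejer_op m n f p) (f p)))"
        using le by (rule bdd_aboveI2)
      then have "fuzzy_D (fejer_op m n f 0) (f 0) \<le> Dstar (fejer_op m n f) f"
        unfolding Dstar_def by (rule cSUP_upper[OF UNIV_I])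
      then show ?thesis
        using zero_le_dist[of "fejer_op m n f 0" "f 0"] unfolding dist_fuzzy_def by linarith
    qed
    moreover have "B < \<epsilon>"
    proof -
      have "C * (1 / (real k + 1)) < \<epsilon> / 4" if "N \<le> k" for k
      proof -
        have "4 * C / \<epsilon> < real k + 1" using N that by linarith
        then show ?thesis using \<open>0 < \<epsilon>\<close> by (simp add: field_simps)
      qed
      from this[OF \<open>N \<le> m\<close>] this[OF \<open>N \<le> n\<close>] show ?thesis
        unfolding B_def distrib_left by linarith
    qed
    ultimately show ?thesis by simp
  qed
  then show "\<exists>N. \<forall>m\<ge>N. \<forall>n\<ge>N. \<bar>Dstar (fejer_op m n f) f - 0\<bar> < \<epsilon>" by blast
qed

end
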